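(* Let $G$ be a hemicompact (Hausdorff) topological group. The following assertions are equivalent: (i) $G$ is $\kappa$-Fréchet–Urysohn; (ii) $G$ is locally compact; (iii) $G$ is Baire.
   Context: All topological groups are assumed Hausdorff (hence Tychonoff). $\omega=\{0,1,2,\dots\}$. A Tychonoff space $X$ is called $\kappa$-Fréchet–Urysohn if, for any open set $U\subseteq X$ and each point $x\in\overline{U}$, there exists a sequence $\{x_n\}_{n\in\omega}\subseteq U$ that converges to $x$. A space $X$ is hemicompact if there is an increasing sequence $\{K_n\}_{n\in\omega}$ of compact subsets of $X$ such that every compact subset of $X$ is contained in some $K_n$. A space is Baire if the intersection of any countable family of dense open subsets is dense. *)

theory Defs
  imports "HOL-Analysis.Analysis"
begin

definition kappa_Frechet_Urysohn_space :: "'a topology \<Rightarrow> bool" where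
  "kappa_Frechet_Urysohn_space X \<longleftrightarrow>
     completely_regular_space X \<and> Hausdorff_space X \<and>
     (\<forall>U x. openin X U \<longrightarrow> x \<in> X closure_of U \<longrightarrow>
        (\<exists>f :: nat \<Rightarrow> 'a. range f \<subseteq> U \<and> limitin X f x sequentially))"

definition hemicompact_space :: "'a topology \<Rightarrow> bool" where
  "hemicompact_space X \<longleftrightarrow>
     (\<exists>K :: nat \<Rightarrow> 'a set. incseq K \<and> (\<forall>n. compactin X (K n)) \<and>
        (\<forall>C. compactin X C \<longrightarrow> (\<exists>n. C \<subseteq> K n)))"

(* The intersection with topspace X only matters for the empty family. *)
definition Baire_space :: "'a topology \<Rightarrow> bool" where
  "Baire_space X \<longleftrightarrow>
     (\<forall>\<U>. countable \<U> \<longrightarrow>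
        (\<forall>U\<in>\<U>. openin X U \<and> X closure_of U = topspace X) \<longrightarrow>
        X closure_of (topspace X \<inter> \<Inter>\<U>) = topspace X)"

end

theory Submission
  imports Defs
begin

text \<open>
  A locally compact group \<open>G\<close> is \<open>\<kappa>\<close>-Frechet-Urysohn for the following reason. Let \<open>x\<close> lie in the
  closure of the open set \<open>U\<close>. Choosing points \<open>u\<^sub>k \<in> (x + V\<^sub>k) \<inter> U\<close> and symmetric neighbourhoods of
  zero with \<open>V\<^sub>k\<^sub>+\<^sub>1 + V\<^sub>k\<^sub>+\<^sub>1 \<subseteq> V\<^sub>k\<close> and \<open>u\<^sub>k + V\<^sub>k\<^sub>+\<^sub>1 \<subseteq> U\<close> in turn, one gets a compact subgroup
  \<open>N = \<Inter>\<^sub>k V\<^sub>k\<close> whose cosets \<open>u\<^sub>k + N \<subseteq> U\<close> converge to \<open>x + N\<close> in \<open>G/N\<close>. Among all sequences of cosets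
  of compact subgroups \<open>M\<close> that lie in \<open>U\<close> and converge to \<open>x + M\<close>, Zorn's lemma gives a minimal one.
  If \<open>M\<close> were nontrivial, the sequence could be lifted to \<open>G/(M \<inter> N)\<close> for some \<open>N\<close> as above with
  \<open>M \<inter> N \<noteq> M\<close>, because \<open>G \<rightarrow> G/M\<close> is open and \<open>N\<close> has a countable neighbourhood base. So \<open>M = {0}\<close>, and
  the cosets are points of \<open>U\<close> converging to \<open>x\<close>.

  Conversely, suppose that all members of a hemicompact exhaustion \<open>(K\<^sub>n)\<close> have empty interior. Baire
  category fails at once. For the \<open>\<kappa>\<close>-Frechet-Urysohn property take \<open>g\<^sub>n \<rightarrow> 0\<close> with \<open>g\<^sub>n \<noteq> 0\<close> and open
  \<open>W\<^sub>n \<ni> g\<^sub>n\<close> whose closures miss \<open>0\<close>: zero is in the closure of \<open>\<Union>\<^sub>n (W\<^sub>n - K\<^sub>n)\<close>, but a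
  sequence in this set converging to zero would lie in some \<open>K\<^sub>m\<close>, hence in \<open>\<Union>\<^sub>n\<^sub><\<^sub>m W\<^sub>n\<close>.
\<close>

section \<open>Compactness and neighbourhoods in topological groups\<close>

lemma finite_chain_has_least:
  fixes F :: "'i \<Rightarrow> 'a set"
  assumes "finite J" "J \<noteq> {}"
    and "\<And>i j. i \<in> J \<Longrightarrow> j \<in> J \<Longrightarrow> F i \<subseteq> F j \<or> F j \<subseteq> F i"
  shows "\<exists>i\<in>J. \<forall>j\<in>J. F i \<subseteq> F j"
  using assms
proof (induction J rule: finite_ne_induct)
  case (singleton x)
  then show ?case by simp
next
  case (insert x J)
  then obtain i where i: "i \<in> J" "\<forall>j\<in>J. F i \<subseteq> F j"
    by (metis insertCI)
  have "F i \<subseteq> F x \<or> F x \<subseteq> F i"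
    using insert.prems i(1) by blast
  then show ?case
    using i by (metis insert_iff order_refl order_trans)
qed

text \<open>The open sets \<open>U \<union> - F i\<close> cover one member. For the least set among
  that member and those of a finite subcover, the complements contribute nothing, so it lies in
  \<open>U\<close>.\<close>

lemma compact_chain_Inter_subset_open:
  fixes F :: "'i \<Rightarrow> 'a::t2_space set"
  assumes "I \<noteq> {}" and compact: "\<And>i. i \<in> I \<Longrightarrow> compact (F i)"
    and chain: "\<And>i j. i \<in> I \<Longrightarrow> j \<in> I \<Longrightarrow> F i \<subseteq> F j \<or> F j \<subseteq> F i"
    and "open U" and sub: "(\<Inter>i\<in>I. F i) \<subseteq> U"
  shows "\<exists>i\<in>I. F i \<subseteq> U"
proof -
  obtain i0 where i0: "i0 \<in> I" using \<open>I \<noteq> {}\<close> by blast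
  have "open (U \<union> - F i)" if "i \<in> I" for i
    using compact[OF that] \<open>open U\<close> by (simp add: compact_imp_closed open_Compl open_Un)
  moreover have "F i0 \<subseteq> (\<Union>i\<in>I. U \<union> - F i)"
    using sub i0 by blast
  ultimately obtain J where J: "J \<subseteq> I" "finite J" "F i0 \<subseteq> (\<Union>i\<in>J. U \<union> - F i)"
    using compactE_image[OF compact[OF i0], of I "\<lambda>i. U \<union> - F i"] by blast
  obtain i where i: "i \<in> insert i0 J" "\<forall>j\<in>insert i0 J. F i \<subseteq> F j"
    using finite_chain_has_least[of "insert i0 J" F] J i0 chain
    by (metis finite_insert insert_not_empty insert_subset subsetD)
  have "F i \<subseteq> U" using i(2) J(3) by blast
  then show ?thesis using i(1) i0 J(1) by blast
qed

lemma compact_chain_Inter_nonempty: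
  fixes F :: "'i \<Rightarrow> 'a::t2_space set"
  assumes "\<And>i. i \<in> I \<Longrightarrow> compact (F i)" "\<And>i. i \<in> I \<Longrightarrow> F i \<noteq> {}"
    and "\<And>i j. i \<in> I \<Longrightarrow> j \<in> I \<Longrightarrow> F i \<subseteq> F j \<or> F j \<subseteq> F i"
  shows "(\<Inter>i\<in>I. F i) \<noteq> {}"
proof
  assume *: "(\<Inter>i\<in>I. F i) = {}"
  then have "I \<noteq> {}" by auto
  then show False
    using compact_chain_Inter_subset_open[of I F "{}"] * assms by auto
qed

section \<open>Translations and small neighbourhoods of zero; addition need not be
  commutative\<close>

lemma left_translation_vimage:
  fixes a :: "'a::group_add"
  shows "(+) a ` S = (\<lambda>y. - a + y) -` S"
proof
  show "(\<lambda>y. - a + y) -` S \<subseteq> (+) a ` S"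
    using image_iff by fastforce
qed (auto simp flip: add.assoc)

lemma mem_left_translation_iff:
  fixes a :: "'a::group_add"
  shows "y \<in> (+) a ` S \<longleftrightarrow> - a + y \<in> S"
  by (simp add: left_translation_vimage)

lemma open_left_translation:
  fixes a :: "'a::topological_group_add"
  shows "open S \<Longrightarrow> open ((+) a ` S)"
  unfolding left_translation_vimage by (intro open_vimage continuous_intros)

lemma compact_left_translation:
  fixes a :: "'a::topological_group_add"
  shows "compact S \<Longrightarrow> compact ((+) a ` S)"
  by (intro compact_continuous_image continuous_intros)

text \<open>With \<open>M\<close> a subgroup this is openness of the quotient map G -> G/M: the
  saturation of \<open>S\<close> is a union of right translates of \<open>S\<close>.\<close>

lemma open_sum_left:
  fixes S :: "'a::topological_group_add set"
  assumes "open S"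
  shows "open {s + m |s m. s \<in> S \<and> m \<in> M}"
proof -
  have "{s + m |s m. s \<in> S \<and> m \<in> M} = (\<Union>m\<in>M. (\<lambda>y. y + - m) -` S)"
  proof (intro set_eqI iffI)
    fix y assume "y \<in> (\<Union>m\<in>M. (\<lambda>y. y + - m) -` S)"
    then obtain m where "m \<in> M" "y + - m \<in> S" by blast
    moreover have "y = (y + - m) + m" by simp
    ultimately show "y \<in> {s + m |s m. s \<in> S \<and> m \<in> M}" by blast
  next
    fix y assume "y \<in> {s + m |s m. s \<in> S \<and> m \<in> M}"
    then obtain s m where s: "s \<in> S" "m \<in> M" "y = s + m" by blast
    then have "y + - m = s" by simp
    then show "y \<in> (\<Union>m\<in>M. (\<lambda>y. y + - m) -` S)" using s by blast
  qed
  moreover have "open ((\<lambda>y. y + - m) -` S)" for m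
    using assms by (intro open_vimage continuous_intros)
  ultimately show ?thesis by auto
qed

lemma zero_nhd_half:
  fixes V :: "'a::topological_group_add set"
  assumes "open V" "0 \<in> V"
  obtains W where "open W" "0 \<in> W" "\<And>a. a \<in> W \<Longrightarrow> - a \<in> W"
    "\<And>a b. a \<in> W \<Longrightarrow> b \<in> W \<Longrightarrow> a + b \<in> V"
proof -
  have "open ((\<lambda>p. fst p + snd p) -` V)"
    using assms by (intro open_vimage continuous_intros)
  moreover have "(0, 0) \<in> (\<lambda>p. fst p + snd p) -` V" using assms by simp
  ultimately obtain A B where AB: "open A" "open B" "(0, 0) \<in> A \<times> B"
      "A \<times> B \<subseteq> (\<lambda>p. fst p + snd p) -` V"
    by (rule open_prod_elim)
  define C where "C = A \<inter> B"
  define W where "W = C \<inter> uminus -` C"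
  have "open C" unfolding C_def using AB by blast
  then have "open (uminus -` C)"
    by (intro open_vimage continuous_intros)
  then have "open W" unfolding W_def using \<open>open C\<close> by blast
  then show ?thesis
    by (rule that) (use AB in \<open>auto simp: W_def C_def\<close>)
qed

text \<open>The neighbourhood \<open>y + W\<close> of a closure point \<open>y\<close> meets
  \<open>W\<close>, so \<open>y\<close> is a difference of two elements of \<open>W\<close>.\<close>

lemma closure_subset_sum:
  fixes W :: "'a::topological_group_add set"
  assumes "open W" "0 \<in> W" "\<And>a. a \<in> W \<Longrightarrow> - a \<in> W"
    "\<And>a b. a \<in> W \<Longrightarrow> b \<in> W \<Longrightarrow> a + b \<in> V"
  shows "closure W \<subseteq> V"
proof
  fix y assume "y \<in> closure W"
  moreover have "open ((+) y ` W)" "y \<in> (+) y ` W"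
    using assms by (auto intro: open_left_translation simp: mem_left_translation_iff)
  ultimately obtain w where "w \<in> W" "y + w \<in> W"
    by (metis (no_types, lifting) closure_iff_nhds_not_empty disjoint_iff imageE order_refl)
  then have "(y + w) + - w \<in> V" using assms by blast
  then show "y \<in> V" by (simp add: add.assoc)
qed

lemma Hausdorff_space_euclidean_t2: "Hausdorff_space (euclidean :: 'a::t2_space topology)"
  unfolding Hausdorff_space_def disjnt_def by simp (metis hausdorff)

lemma locally_compact_group_iff:
  "locally_compact_space (euclidean :: 'a::{topological_group_add, t2_space} topology) \<longleftrightarrow>
    (\<exists>K :: 'a set. compact K \<and> interior K \<noteq> {})"
proof
  assume "locally_compact_space (euclidean :: 'a topology)"
  then obtain U K :: "'a set" where "open U" "compact K" "0 \<in> U" "U \<subseteq> K"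
    unfolding locally_compact_space_def by simp metis
  then show "\<exists>K :: 'a set. compact K \<and> interior K \<noteq> {}"
    using interior_maximal by blast
next
  assume "\<exists>K :: 'a set. compact K \<and> interior K \<noteq> {}"
  then obtain K :: "'a set" and y where K: "compact K" "y \<in> interior K" by blast
  show "locally_compact_space (euclidean :: 'a topology)"
    unfolding locally_compact_space_def
  proof
    fix x :: 'a
    \<comment> \<open>Left translation by \<open>x - y\<close> carries the interior point
      \<open>y\<close> to \<open>x\<close>, so one compact set with interior serves every
      point.\<close>
    have "open ((+) (x - y) ` interior K)" "compact ((+) (x - y) ` K)"
      using K by (auto intro: open_left_translation compact_left_translation)
    moreover have "x \<in> (+) (x - y) ` interior K"
      using K(2) by (metis diff_add_cancel image_eqI)
    moreover have "(+) (x - y) ` interior K \<subseteq> (+) (x - y) ` K"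
      using interior_subset by blast
    ultimately show "\<exists>U K. openin euclidean U \<and> compactin euclidean K \<and> x \<in> U \<and> U \<subseteq> K"
      by auto
  qed
qed

section \<open>Chains of neighbourhoods of zero\<close>

text \<open>Symmetry starts at index 1, so \<open>V 0\<close> may be any prescribed open
  neighbourhood of zero with compact closure.\<close>

definition halving_chain :: "(nat \<Rightarrow> 'a::topological_group_add set) \<Rightarrow> bool" where
  "halving_chain V \<longleftrightarrow> compact (closure (V 0)) \<and>
     (\<forall>k. open (V k) \<and> 0 \<in> V k \<and> (\<forall>a\<in>V (Suc k). - a \<in> V (Suc k)) \<and>
       (\<forall>a\<in>V (Suc k). \<forall>b\<in>V (Suc k). a + b \<in> V k))"

definition compact_subgroup :: "'a::topological_group_add set \<Rightarrow> bool" where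
  "compact_subgroup M \<longleftrightarrow> compact M \<and> 0 \<in> M \<and> (\<forall>a\<in>M. - a \<in> M) \<and> (\<forall>a\<in>M. \<forall>b\<in>M. a + b \<in> M)"

lemma halving_chainD:
  assumes "halving_chain V"
  shows "compact (closure (V 0))" "open (V k)" "0 \<in> V k"
    "a \<in> V (Suc k) \<Longrightarrow> - a \<in> V (Suc k)"
    "a \<in> V (Suc k) \<Longrightarrow> b \<in> V (Suc k) \<Longrightarrow> a + b \<in> V k"
  using assms by (auto simp: halving_chain_def)

lemma halving_chain_closure_Suc:
  assumes "halving_chain V"
  shows "closure (V (Suc k)) \<subseteq> V k"
  using halving_chainD[OF assms] by (intro closure_subset_sum) auto

lemma halving_chain_decseq:
  assumes "halving_chain V"
  shows "decseq V"
  using halving_chain_closure_Suc[OF assms] closure_subset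
  by (intro decseq_SucI) blast

lemma halving_chain_compact_closure:
  fixes V :: "nat \<Rightarrow> 'a::{topological_group_add, t2_space} set"
  assumes "halving_chain V"
  shows "compact (closure (V k))"
proof -
  have "closure (V k) \<subseteq> closure (V 0)"
    using halving_chain_decseq[OF assms] by (simp add: closure_mono decseqD)
  then show ?thesis
    using halving_chainD(1)[OF assms] by (metis closed_closure compact_Int_closed inf.absorb2)
qed

text \<open>Presents the intersection as one of compact sets, so that the lemmas on compact chains
  apply to it.\<close>

lemma halving_chain_Inter_closure:
  assumes "halving_chain V"
  shows "(\<Inter>k. closure (V k)) = (\<Inter>k. V k)"
  using halving_chain_closure_Suc[OF assms] closure_subset by blast

lemma compact_subgroup_Inter_halving_chain:
  fixes V :: "nat \<Rightarrow> 'a::{topological_group_add, t2_space} set"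
  assumes "halving_chain V"
  shows "compact_subgroup (\<Inter>k. V k)"
proof -
  note V = halving_chainD[OF assms]
  have "compact (closure (V 0) \<inter> (\<Inter>k. closure (V k)))"
    using V(1) by (intro compact_Int_closed) auto
  moreover have "closure (V 0) \<inter> (\<Inter>k. closure (V k)) = (\<Inter>k. V k)"
    using halving_chain_Inter_closure[OF assms] by blast
  moreover have "- a \<in> (\<Inter>k. V k)" if "a \<in> (\<Inter>k. V k)" for a
  proof
    fix k
    have "- a \<in> V (Suc k)" using V(4) that by blast
    then show "- a \<in> V k"
      using halving_chain_decseq[OF assms] unfolding decseq_Suc_iff by blast
  qed
  moreover have "a + b \<in> (\<Inter>k. V k)" if "a \<in> (\<Inter>k. V k)" "b \<in> (\<Inter>k. V k)" for a b
    using V(5) that by blast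
  ultimately show ?thesis
    using V(3) by (auto simp: compact_subgroup_def)
qed

lemma halving_chain_along_open_set:
  fixes U :: "'a::topological_group_add set"
  assumes "open U" "x \<in> closure U" "open V0" "0 \<in> V0" "compact (closure V0)"
  shows "\<exists>V u. halving_chain V \<and> V 0 = V0 \<and>
    (\<forall>k. u k \<in> (+) x ` V k \<and> (+) (u k) ` V (Suc k) \<subseteq> U)"
proof -
  \<comment> \<open>\<open>P\<close> is the invariant of the pair \<open>(V k, u k)\<close>.
    \<open>Q\<close> ties \<open>u k\<close> to the next neighbourhood, because
    \<open>V (Suc k)\<close> has to be chosen after \<open>u k\<close>.\<close>
  define P where "P = (\<lambda>k (V, u). open V \<and> 0 \<in> V \<and> (k = (0::nat) \<longrightarrow> V = V0) \<and>
    u \<in> (+) x ` V \<and> u \<in> U)"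
  define Q where "Q = (\<lambda>(k::nat) (V, u) (W, v :: 'a). (\<forall>a\<in>W. - a \<in> W) \<and>
    (\<forall>a\<in>W. \<forall>b\<in>W. a + b \<in> V) \<and> (+) u ` W \<subseteq> U)"
  have point: "\<exists>u. u \<in> (+) x ` V \<and> u \<in> U" if "open V" "0 \<in> V" for V
  proof -
    have "open ((+) x ` V)" "x \<in> (+) x ` V"
      using that by (auto intro: open_left_translation simp: mem_left_translation_iff)
    then show ?thesis
      using assms(2) by (metis (no_types, lifting) closure_iff_nhds_not_empty disjoint_iff order_refl)
  qed
  have "\<exists>f. \<forall>n. P n (f n) \<and> Q n (f n) (f (Suc n))"
  proof (rule dependent_nat_choice)
    show "\<exists>p. P 0 p" using point[of V0] assms by (auto simp: P_def)
  next
    fix p n assume "P n p"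
    then obtain V u where p: "p = (V, u)" "open V" "0 \<in> V" "u \<in> U"
      by (auto simp: P_def)
    \<comment> \<open>Halving this smaller set keeps \<open>u + W\<close> inside \<open>U\<close>,
      as \<open>w = w + 0\<close>.\<close>
    have "open (V \<inter> (+) (- u) ` U)" "0 \<in> V \<inter> (+) (- u) ` U"
      using p assms(1) by (auto intro: open_left_translation simp: mem_left_translation_iff)
    then obtain W where W: "open W" "0 \<in> W" "\<And>a. a \<in> W \<Longrightarrow> - a \<in> W"
        "\<And>a b. a \<in> W \<Longrightarrow> b \<in> W \<Longrightarrow> a + b \<in> V \<inter> (+) (- u) ` U"
      by (rule zero_nhd_half) blast
    have "u + w \<in> U" if "w \<in> W" for w
      using W(4)[OF that W(2)] by (simp add: mem_left_translation_iff)
    moreover obtain v where "v \<in> (+) x ` W" "v \<in> U" using point[OF W(1,2)] by blast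
    ultimately have "P (Suc n) (W, v) \<and> Q n p (W, v)"
      using W p by (auto simp: P_def Q_def)
    then show "\<exists>q. P (Suc n) q \<and> Q n p q" by blast
  qed
  then obtain f where f: "\<And>n. P n (f n)" "\<And>n. Q n (f n) (f (Suc n))" by blast
  show ?thesis
  proof (intro exI conjI allI)
    show "halving_chain (\<lambda>n. fst (f n))" "fst (f 0) = V0"
      using f assms(5) by (auto simp: halving_chain_def P_def Q_def case_prod_beta)
    show "snd (f k) \<in> (+) x ` fst (f k)" for k
      using f(1)[of k] by (auto simp: P_def case_prod_beta)
    show "(+) (snd (f k)) ` fst (f (Suc k)) \<subseteq> U" for k
      using f(2)[of k] by (auto simp: Q_def case_prod_beta)
  qed
qed

section \<open>Convergent sequences of cosets\<close>

text \<open>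
  The last clause is convergence to \<open>x + M\<close> in \<open>G/M\<close>: by compactness of \<open>M\<close>, every open set containing
  \<open>x + M\<close> contains an \<open>M\<close>-saturated one. Stated this way it passes to intersections of chains.
\<close>

definition coset_seq :: "'a::topological_group_add set \<Rightarrow> 'a \<Rightarrow> 'a set \<times> (nat \<Rightarrow> 'a set) \<Rightarrow> bool" where
  "coset_seq U x = (\<lambda>(M, A). compact_subgroup M \<and> (\<forall>n. (\<exists>a. A n = (+) a ` M) \<and> A n \<subseteq> U) \<and>
     (\<forall>S. open S \<longrightarrow> (+) x ` M \<subseteq> S \<longrightarrow> (\<forall>\<^sub>F n in sequentially. A n \<subseteq> S)))"

text \<open>The smaller pair stands on the right, so that a maximal element in Zorn's lemma is a
  minimal coset sequence.\<close>

definition refines :: "'a set \<times> (nat \<Rightarrow> 'a set) \<Rightarrow> 'a set \<times> (nat \<Rightarrow> 'a set) \<Rightarrow> bool" where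
  "refines p q \<longleftrightarrow> fst q \<subseteq> fst p \<and> (\<forall>n. snd q n \<subseteq> snd p n)"

lemma coset_eq:
  assumes "compact_subgroup M" "b \<in> (+) a ` M"
  shows "(+) a ` M = (+) b ` M"
proof -
  obtain m where m: "m \<in> M" "b = a + m" using assms(2) by blast
  have "- a + y \<in> M \<longleftrightarrow> - b + y \<in> M" for y
  proof
    assume "- a + y \<in> M"
    then have "- m + (- a + y) \<in> M" using assms(1) m by (auto simp: compact_subgroup_def)
    then show "- b + y \<in> M" by (simp only: m minus_add add.assoc)
  next
    assume "- b + y \<in> M"
    then have "m + (- b + y) \<in> M" using assms(1) m by (auto simp: compact_subgroup_def)
    then show "- a + y \<in> M" by (simp only: m minus_add flip: add.assoc) simp
  qed
  then show ?thesis by (intro set_eqI) (simp only: mem_left_translation_iff)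
qed

text \<open>Supplies the bound of the empty chain in Zorn's lemma.\<close>

lemma coset_seq_exists:
  fixes U V0 :: "'a::{topological_group_add, t2_space} set"
  assumes "open U" "x \<in> closure U" "open V0" "0 \<in> V0" "compact (closure V0)"
  shows "\<exists>p. coset_seq U x p"
proof -
  obtain V u where V: "halving_chain V" and u: "\<And>k. u k \<in> (+) x ` V k"
      "\<And>k. (+) (u k) ` V (Suc k) \<subseteq> U"
    using halving_chain_along_open_set[OF assms] by metis
  define N where "N = (\<Inter>k. V k)"
  have "\<forall>\<^sub>F n in sequentially. (+) (u n) ` N \<subseteq> S" if S: "open S" "(+) x ` N \<subseteq> S" for S
  proof -
    have "open ((+) (- x) ` S)" using S(1) by (rule open_left_translation)
    moreover have "(\<Inter>k. closure (V k)) \<subseteq> (+) (- x) ` S"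
      using S(2) halving_chain_Inter_closure[OF V]
      by (auto simp: mem_left_translation_iff N_def image_subset_iff)
    ultimately have "\<exists>k\<in>UNIV. closure (V k) \<subseteq> (+) (- x) ` S"
      using halving_chain_decseq[OF V] halving_chain_compact_closure[OF V]
      by (intro compact_chain_Inter_subset_open)
        (auto, metis closure_mono decseqD nle_le subsetD)
    then obtain k where k: "V k \<subseteq> (+) (- x) ` S" using closure_subset by blast
    \<comment> \<open>From \<open>Suc k\<close> on, \<open>- x + u n\<close> lies in
      \<open>V (Suc k)\<close>, which also contains \<open>N\<close>; the spare index pays for one
      addition.\<close>
    have "(+) (u n) ` N \<subseteq> S" if "n \<ge> Suc k" for n
    proof
      fix y assume "y \<in> (+) (u n) ` N"
      then have "- u n + y \<in> V (Suc k)" by (simp add: mem_left_translation_iff N_def)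
      moreover have "- x + u n \<in> V (Suc k)"
        using u(1)[of n] decseqD[OF halving_chain_decseq[OF V] that]
        by (auto simp: mem_left_translation_iff)
      ultimately have "(- x + u n) + (- u n + y) \<in> V k"
        using halving_chainD(5)[OF V] by blast
      then show "y \<in> S"
        using k by (auto simp: add.assoc mem_left_translation_iff)
    qed
    then show ?thesis by (auto simp: eventually_sequentially)
  qed
  moreover have "(+) (u n) ` N \<subseteq> U" for n
    using u(2)[of n] by (auto simp: N_def)
  ultimately have "coset_seq U x (N, \<lambda>n. (+) (u n) ` N)"
    using compact_subgroup_Inter_halving_chain[OF V] by (auto simp: coset_seq_def N_def)
  then show ?thesis by blast
qed

text \<open>The open set \<open>S + M\<close> contains \<open>x + M\<close>, hence eventually
  \<open>A n\<close>. A representative \<open>s + m\<close> of \<open>A n\<close> can then be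
  replaced by \<open>s\<close>, which lies in the same coset.\<close>

lemma coset_seq_meets_nhd:
  assumes "coset_seq U x (M, A)" "open S" "x \<in> S"
  shows "\<forall>\<^sub>F n in sequentially. A n \<inter> S \<noteq> {}"
proof -
  have M: "compact_subgroup M" using assms by (simp add: coset_seq_def)
  have "(+) x ` M \<subseteq> {s + m |s m. s \<in> S \<and> m \<in> M}" using assms(3) by blast
  then have "\<forall>\<^sub>F n in sequentially. A n \<subseteq> {s + m |s m. s \<in> S \<and> m \<in> M}"
    using assms(1) open_sum_left[OF assms(2)] by (auto simp: coset_seq_def)
  then show ?thesis
  proof (rule eventually_mono)
    fix n assume n: "A n \<subseteq> {s + m |s m. s \<in> S \<and> m \<in> M}"
    obtain a where a: "A n = (+) a ` M" using assms(1) unfolding coset_seq_def split by metis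
    have "a \<in> A n" using M by (simp add: a mem_left_translation_iff compact_subgroup_def)
    then obtain s m where s: "s \<in> S" "m \<in> M" "a = s + m" using n by blast
    have "- a + s = - m" by (simp add: s minus_add add.assoc)
    then have "s \<in> A n"
      using M s by (simp add: a mem_left_translation_iff compact_subgroup_def)
    then show "A n \<inter> S \<noteq> {}" using s by blast
  qed
qed

lemma eventually_diagonal_selection:
  assumes "\<And>k::nat. \<forall>\<^sub>F n in sequentially. R k n" "\<And>k n. R (Suc k) n \<Longrightarrow> R k n"
  shows "\<exists>h. filterlim h at_top sequentially \<and> (\<forall>n. h n = 0 \<or> R (h n) n)"
proof -
  \<comment> \<open>The largest level reached at \<open>n\<close>. The cap \<open>k \<le> n\<close>
    keeps the set finite, and 0 is the default when no level is reached.\<close>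
  define h where "h = (\<lambda>n. Max (insert 0 {k. k \<le> n \<and> R k n}))"
  have anti: "R k n" if "R l n" "k \<le> l" for k l n
    using that(2,1) by (induction k rule: inc_induct) (auto intro: assms(2))
  have "h n = 0 \<or> R (h n) n" for n
    using Max_in[of "insert 0 {k. k \<le> n \<and> R k n}"] unfolding h_def by auto
  moreover have "filterlim h at_top sequentially"
    unfolding filterlim_at_top
  proof
    fix k
    show "\<forall>\<^sub>F n in sequentially. k \<le> h n"
      using assms(1)[of k] eventually_ge_at_top[of k]
      by eventually_elim (simp add: h_def)
  qed
  ultimately show ?thesis by blast
qed

lemma coset_seq_proper_refinement:
  fixes U V0 :: "'a::{topological_group_add, t2_space} set"
  assumes seq: "coset_seq U x (M, A)" and m: "m \<in> M" "m \<noteq> 0"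
    and V0: "open V0" "0 \<in> V0" "compact (closure V0)"
  shows "\<exists>q. coset_seq U x q \<and> refines (M, A) q \<and> q \<noteq> (M, A)"
proof -
  \<comment> \<open>Deleting \<open>m\<close> keeps it out of \<open>N\<close>, which makes
    \<open>M \<inter> N\<close> a proper subgroup of \<open>M\<close>.\<close>
  define V0' where "V0' = V0 - {m}"
  have "closure V0' \<subseteq> closure V0" by (simp add: V0'_def closure_mono)
  then have "compact (closure V0')"
    using V0(3) by (metis closed_closure compact_Int_closed inf.absorb2)
  moreover have "open V0'" "0 \<in> V0'" using V0 m by (auto simp: V0'_def intro: open_delete)
  \<comment> \<open>With \<open>UNIV\<close> as the open set only the chain itself matters.\<close>
  ultimately obtain V where V: "halving_chain V" "V 0 = V0'"
    using halving_chain_along_open_set[of UNIV 0 V0'] by auto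
  define N where "N = (\<Inter>k. V k)"
  have N: "compact_subgroup N"
    unfolding N_def by (rule compact_subgroup_Inter_halving_chain[OF V(1)])
  have M: "compact_subgroup M" using seq by (simp add: coset_seq_def)
  have "m \<notin> N" using V(2) by (auto simp: N_def V0'_def)
  define R where "R = (\<lambda>k n. A n \<inter> (+) x ` V k \<noteq> {})"
  have "\<forall>\<^sub>F n in sequentially. R k n" for k
    unfolding R_def using halving_chainD[OF V(1)]
    by (intro coset_seq_meets_nhd[OF seq] open_left_translation) (auto simp: mem_left_translation_iff)
  moreover have "R k n" if "R (Suc k) n" for k n
    using that halving_chain_decseq[OF V(1)] unfolding R_def decseq_Suc_iff by blast
  ultimately obtain h where h: "filterlim h at_top sequentially" "\<And>n. h n = 0 \<or> R (h n) n"
    using eventually_diagonal_selection[of R] by metis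
  \<comment> \<open>Representatives are taken as close to \<open>x\<close> as level
    \<open>h n\<close> allows; at level 0 any point of \<open>A n\<close> will do.\<close>
  have "\<exists>a. a \<in> A n \<and> (h n > 0 \<longrightarrow> a \<in> (+) x ` V (h n))" for n
  proof (cases "h n = 0")
    case True
    obtain a where "A n = (+) a ` M" using seq unfolding coset_seq_def split by metis
    then show ?thesis using True M by (auto simp: compact_subgroup_def)
  next
    case False
    then show ?thesis using h(2)[of n] by (auto simp: R_def)
  qed
  then obtain a where a: "\<And>n. a n \<in> A n" "\<And>n. h n > 0 \<Longrightarrow> a n \<in> (+) x ` V (h n)" by metis
  have A: "A n = (+) (a n) ` M" for n
  proof -
    obtain b where b: "A n = (+) b ` M" using seq unfolding coset_seq_def split by metis
    then show ?thesis using coset_eq[OF M] a(1)[of n] by metis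
  qed
  define B where "B = (\<lambda>n. (+) (a n) ` (M \<inter> N))"
  have BA: "B n \<subseteq> A n" for n by (auto simp: B_def A)
  have near: "\<forall>\<^sub>F n in sequentially. B n \<subseteq> (+) x ` V k" for k
  proof -
    have "\<forall>\<^sub>F n in sequentially. Suc k \<le> h n" using h(1) by (simp add: filterlim_at_top)
    then show ?thesis
    proof (rule eventually_mono)
      fix n assume n: "Suc k \<le> h n"
      show "B n \<subseteq> (+) x ` V k"
      proof
        fix y assume "y \<in> B n"
        then have "- a n + y \<in> V (Suc k)" by (simp add: B_def mem_left_translation_iff N_def)
        moreover have "- x + a n \<in> V (Suc k)"
          using a(2)[of n] n decseqD[OF halving_chain_decseq[OF V(1)] n]
          by (auto simp: mem_left_translation_iff)
        ultimately have "(- x + a n) + (- a n + y) \<in> V k"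
          using halving_chainD(5)[OF V(1)] by blast
        then show "y \<in> (+) x ` V k" by (simp add: add.assoc mem_left_translation_iff)
      qed
    qed
  qed
  have "\<forall>\<^sub>F n in sequentially. B n \<subseteq> S" if S: "open S" "(+) x ` (M \<inter> N) \<subseteq> S" for S
  proof -
    \<comment> \<open>These compact sets decrease to \<open>x + (M \<inter> N)\<close>, so one of
      them lies in \<open>S\<close>.\<close>
    define F where "F = (\<lambda>k. (+) x ` M \<inter> (+) x ` closure (V k))"
    have F_compact: "compact (F k)" for k
      unfolding F_def using M halving_chain_compact_closure[OF V(1)]
      by (auto intro!: compact_Int compact_left_translation simp: compact_subgroup_def)
    have F_dec: "F l \<subseteq> F k" if "k \<le> l" for k l
      using decseqD[OF halving_chain_decseq[OF V(1)] that] closure_mono unfolding F_def by blast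
    have "(\<Inter>k. F k) \<subseteq> S"
      using S(2) halving_chain_Inter_closure[OF V(1)]
      by (force simp: F_def mem_left_translation_iff N_def)
    then have "\<exists>k\<in>UNIV. F k \<subseteq> S"
      using S(1) F_compact F_dec
      by (intro compact_chain_Inter_subset_open) (auto, metis nle_le subsetD)
    then obtain k where k: "F k \<subseteq> S" by blast
    have "closed ((+) x ` closure (V k))"
      by (intro compact_imp_closed compact_left_translation halving_chain_compact_closure[OF V(1)])
    \<comment> \<open>Convergence modulo \<open>M\<close> puts \<open>A n\<close> into this open
      set, and \<open>near\<close> keeps \<open>B n\<close> off the complement part, which leaves
      \<open>S\<close>.\<close>
    then have "open (S \<union> - (+) x ` closure (V k))" using S(1) by auto
    moreover have "(+) x ` M \<subseteq> S \<union> - (+) x ` closure (V k)" using k by (auto simp: F_def)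
    ultimately have "\<forall>\<^sub>F n in sequentially. A n \<subseteq> S \<union> - (+) x ` closure (V k)"
      using seq by (auto simp: coset_seq_def)
    then show ?thesis
      using near[of k]
    proof eventually_elim
      case (elim n)
      then show ?case using BA[of n] closure_subset[of "V k"] by blast
    qed
  qed
  moreover have "compact_subgroup (M \<inter> N)"
    using M N by (auto simp: compact_subgroup_def intro: compact_Int)
  ultimately have "coset_seq U x (M \<inter> N, B)"
    using BA seq by (fastforce simp: coset_seq_def B_def)
  moreover have "refines (M, A) (M \<inter> N, B)" using BA by (simp add: refines_def)
  moreover have "(M \<inter> N, B) \<noteq> (M, A)" using m \<open>m \<notin> N\<close> by auto
  ultimately show ?thesis by blast
qed

text \<open>Members are intersected. Compactness gives the cosets at each index a common point; it
  represents all of them, so they intersect in a coset of the intersected subgroup.\<close>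

lemma coset_seq_chain_bound:
  fixes U :: "'a::{topological_group_add, t2_space} set"
  assumes "C \<noteq> {}" and seq: "\<And>p. p \<in> C \<Longrightarrow> coset_seq U x p"
    and chain: "\<And>p q. p \<in> C \<Longrightarrow> q \<in> C \<Longrightarrow> refines p q \<or> refines q p"
  shows "\<exists>u. coset_seq U x u \<and> (\<forall>p\<in>C. refines p u)"
proof -
  define M where "M = (\<Inter>p\<in>C. fst p)"
  define A where "A = (\<lambda>n. \<Inter>p\<in>C. snd p n)"
  have sub: "compact_subgroup (fst p)" if "p \<in> C" for p
    using seq[OF that] by (auto simp: coset_seq_def case_prod_beta)
  have coset: "\<exists>a. snd p n = (+) a ` fst p" if "p \<in> C" for p n
    using seq[OF that] by (auto simp: coset_seq_def case_prod_beta)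
  have conv: "\<forall>\<^sub>F n in sequentially. snd p n \<subseteq> S"
    if "p \<in> C" "open S" "(+) x ` fst p \<subseteq> S" for p S
    using seq[OF that(1)] that(2,3) by (auto simp: coset_seq_def case_prod_beta)
  obtain p0 where p0: "p0 \<in> C" using \<open>C \<noteq> {}\<close> by blast
  have "compact M"
  proof -
    have "closed (fst p)" if "p \<in> C" for p
      using sub[OF that] by (simp add: compact_subgroup_def compact_imp_closed)
    then have "compact (fst p0 \<inter> M)"
      unfolding M_def using sub[OF p0] by (intro compact_Int_closed) (auto simp: compact_subgroup_def)
    moreover have "fst p0 \<inter> M = M" using p0 by (auto simp: M_def)
    ultimately show ?thesis by simp
  qed
  then have M: "compact_subgroup M"
    using sub by (auto simp: M_def compact_subgroup_def)
  have "\<exists>a. A n = (+) a ` M" for n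
  proof -
    have "A n \<noteq> {}"
      unfolding A_def
    proof (rule compact_chain_Inter_nonempty)
      fix p assume "p \<in> C"
      then show "compact (snd p n)" "snd p n \<noteq> {}"
        using coset[of p n] sub[of p] by (auto simp: compact_subgroup_def intro: compact_left_translation)
    next
      fix p q assume "p \<in> C" "q \<in> C"
      then show "snd p n \<subseteq> snd q n \<or> snd q n \<subseteq> snd p n"
        using chain[of p q] unfolding refines_def by blast
    qed
    then obtain a where a: "a \<in> A n" by blast
    have "snd p n = (+) a ` fst p" if "p \<in> C" for p
    proof -
      have "a \<in> snd p n" using a that by (auto simp: A_def)
      then show ?thesis using coset[OF that, of n] coset_eq[OF sub[OF that]] by metis
    qed
    then have "A n = (\<Inter>p\<in>C. (+) a ` fst p)" by (simp add: A_def)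
    then have "A n = (+) a ` M" by (auto simp: M_def mem_left_translation_iff)
    then show ?thesis by blast
  qed
  moreover have "\<forall>\<^sub>F n in sequentially. A n \<subseteq> S" if S: "open S" "(+) x ` M \<subseteq> S" for S
  proof -
    \<comment> \<open>By compactness one member of the chain already has \<open>x + fst p\<close>
      inside \<open>S\<close>, and its convergence passes to the smaller \<open>A n\<close>.\<close>
    have "\<exists>p\<in>C. (+) x ` fst p \<subseteq> S"
    proof (rule compact_chain_Inter_subset_open[OF \<open>C \<noteq> {}\<close> _ _ S(1)])
      show "compact ((+) x ` fst p)" if "p \<in> C" for p
        using sub[OF that] by (auto simp: compact_subgroup_def intro: compact_left_translation)
      show "(+) x ` fst p \<subseteq> (+) x ` fst q \<or> (+) x ` fst q \<subseteq> (+) x ` fst p"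
        if "p \<in> C" "q \<in> C" for p q
        using chain[OF that] by (auto simp: refines_def)
      show "(\<Inter>p\<in>C. (+) x ` fst p) \<subseteq> S"
        using S(2) by (auto simp: M_def mem_left_translation_iff subset_iff)
    qed
    then obtain p where p: "p \<in> C" "(+) x ` fst p \<subseteq> S" by blast
    show ?thesis
      using conv[OF p(1) S(1) p(2)] by (rule eventually_mono) (use p(1) in \<open>auto simp: A_def\<close>)
  qed
  moreover have "A n \<subseteq> U" for n
    using seq[OF p0] p0 by (auto simp: coset_seq_def A_def case_prod_beta)
  ultimately have "coset_seq U x (M, A)" using M by (auto simp: coset_seq_def)
  moreover have "refines p (M, A)" if "p \<in> C" for p
    using that by (auto simp: refines_def M_def A_def)
  ultimately show ?thesis by blast
qed

section \<open>From a minimal coset sequence to a convergent sequence of points\<close>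

lemma locally_compact_group_sequence:
  fixes U :: "'a::{topological_group_add, t2_space} set"
  assumes lc: "locally_compact_space (euclidean :: 'a topology)" and U: "open U" "x \<in> closure U"
  shows "\<exists>f. range f \<subseteq> U \<and> f \<longlonglongrightarrow> x"
proof -
  obtain V0 K :: "'a set" where V0: "open V0" "compact K" "0 \<in> V0" "V0 \<subseteq> K"
    using lc unfolding locally_compact_space_def by simp metis
  have "closure V0 \<subseteq> K" using V0 by (simp add: closure_minimal compact_imp_closed)
  then have cV0: "compact (closure V0)"
    using V0(2) by (metis closed_closure compact_Int_closed inf.absorb2)
  let ?Q = "{p. coset_seq U x p}"
  have "\<exists>p\<in>?Q. \<forall>q\<in>?Q. refines p q \<longrightarrow> q = p"
  proof (rule predicate_Zorn)
    show "partial_order_on ?Q (relation_of refines ?Q)"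
      by (rule partial_order_on_relation_ofI) (auto simp: refines_def prod_eq_iff fun_eq_iff subset_antisym, blast+)
  next
    fix C assume C: "C \<in> Chains (relation_of refines ?Q)"
    then have C': "p \<in> C \<Longrightarrow> coset_seq U x p" for p
      by (auto simp: Chains_def relation_of_def)
    have C'': "refines p q \<or> refines q p" if "p \<in> C" "q \<in> C" for p q
      using C that by (auto simp: Chains_def relation_of_def)
    show "\<exists>u\<in>?Q. \<forall>p\<in>C. refines p u"
    proof (cases "C = {}")
      case True
      then show ?thesis using coset_seq_exists[OF U V0(1,3) cV0] by auto
    next
      case False
      then show ?thesis using coset_seq_chain_bound[OF False C' C''] by auto
    qed
  qed
  then obtain M A where MA: "coset_seq U x (M, A)"
      "\<And>q. coset_seq U x q \<Longrightarrow> refines (M, A) q \<Longrightarrow> q = (M, A)"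
    by auto
  have "m = 0" if "m \<in> M" for m
    using coset_seq_proper_refinement[OF MA(1) that _ V0(1,3) cV0] MA(2) by blast
  moreover have "0 \<in> M" using MA(1) by (simp add: coset_seq_def compact_subgroup_def)
  ultimately have "M = {0}" by blast
  then have A: "\<forall>n. \<exists>a. A n = {a}" and AU: "\<And>n. A n \<subseteq> U"
    using MA(1) by (auto simp: coset_seq_def)
  from A obtain f where f: "\<And>n. A n = {f n}" by metis
  have "f \<longlonglongrightarrow> x"
    using MA(1) by (auto simp: tendsto_def coset_seq_def f \<open>M = {0}\<close>)
  then show ?thesis using AU f by auto
qed

section \<open>The equivalences\<close>

lemma locally_compact_group_imp_kappa_Frechet_Urysohn:
  assumes "locally_compact_space (euclidean :: 'a::{topological_group_add, t2_space} topology)"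
  shows "kappa_Frechet_Urysohn_space (euclidean :: 'a topology)"
  unfolding kappa_Frechet_Urysohn_space_def
  using locally_compact_group_sequence[OF assms] assms Hausdorff_space_euclidean_t2
  by (auto intro: locally_compact_regular_imp_completely_regular_space)

lemma locally_compact_Hausdorff_imp_Baire_space:
  assumes "locally_compact_space X" "Hausdorff_space X"
  shows "Baire_space X"
  unfolding Baire_space_def
proof (intro allI impI)
  fix \<U> assume U: "countable \<U>" "\<forall>U\<in>\<U>. openin X U \<and> X closure_of U = topspace X"
  have "X closure_of \<Inter>\<U> = topspace X"
    using U assms locally_compact_Hausdorff_imp_regular_space[OF assms]
    by (intro Baire_category) auto
  then show "X closure_of (topspace X \<inter> \<Inter>\<U>) = topspace X"
    by (metis closure_of_restrict)
qed

text \<open>Otherwise the complements of the \<open>K n\<close> would be dense open sets with empty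
  intersection.\<close>

lemma Baire_sigma_compact_has_interior:
  fixes K :: "nat \<Rightarrow> 'a::t2_space set"
  assumes "Baire_space (euclidean :: 'a topology)" "\<And>n. compact (K n)" "(\<Union>n. K n) = UNIV"
  shows "\<exists>n. interior (K n) \<noteq> {}"
proof (rule ccontr)
  assume "\<not> ?thesis"
  then have "\<forall>U\<in>range (\<lambda>n. - K n). openin euclidean U \<and> euclidean closure_of U = topspace euclidean"
    using assms(2) by (auto simp: closure_complement compact_imp_closed open_Compl)
  then have "euclidean closure_of (topspace euclidean \<inter> (\<Inter>n. - K n)) = (topspace euclidean :: 'a set)"
    using assms(1) by (simp add: Baire_space_def)
  moreover have "(\<Inter>n. - K n) = {}" using assms(3) by blast
  ultimately show False by simp
qed

lemma hemicompact_kappa_Frechet_Urysohn_has_interior: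
  fixes K :: "nat \<Rightarrow> 'a::{topological_group_add, t2_space} set"
  assumes kFU: "kappa_Frechet_Urysohn_space (euclidean :: 'a topology)"
    and "incseq K" and compact: "\<And>n. compact (K n)"
    and exhaust: "\<And>C. compact C \<Longrightarrow> \<exists>n. C \<subseteq> K n"
  shows "\<exists>n. interior (K n) \<noteq> {}"
proof (rule ccontr)
  assume "\<not> ?thesis"
  then have int: "interior (K n) = {}" for n by blast
  have lim: "\<exists>f. range f \<subseteq> U \<and> f \<longlonglongrightarrow> x" if "open U" "x \<in> closure U" for U and x :: 'a
    using kFU that by (auto simp: kappa_Frechet_Urysohn_space_def)
  obtain n0 where n0: "{0} \<subseteq> K n0" using exhaust[of "{0}"] by auto
  \<comment> \<open>Zero is not isolated, since it lies in a compact \<open>K n0\<close> without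
    interior; hence nonzero points converge to it.\<close>
  have "interior {0::'a} = {}" using interior_mono[OF n0] int by blast
  then have "0 \<in> closure (- {0::'a})" by (simp add: closure_complement)
  then obtain g :: "nat \<Rightarrow> 'a" where g: "\<And>n. g n \<noteq> 0" "g \<longlonglongrightarrow> 0"
    using lim[of "- {0}" 0] by (auto simp: image_iff)
  have "\<exists>W S. open W \<and> g n \<in> W \<and> open S \<and> 0 \<in> S \<and> W \<inter> S = {}" for n
    using hausdorff[OF g(1)] by metis
  then obtain W S where W: "\<And>n. open (W n)" "\<And>n. g n \<in> W n"
      and S: "\<And>n. open (S n)" "\<And>n. 0 \<in> S n" "\<And>n. W n \<inter> S n = {}"
    by metis
  \<comment> \<open>Points of \<open>U\<close> inside \<open>K m\<close> come from indices below
    \<open>m\<close>, and finitely many \<open>W n\<close> together stay away from zero.\<close>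
  define U where "U = (\<Union>n. W n - K n)"
  have "open U" unfolding U_def using W compact by (auto intro!: open_Diff compact_imp_closed)
  moreover have "0 \<in> closure U"
    unfolding closure_iff_nhds_not_empty
  proof (intro allI impI)
    fix T Z :: "'a set" assume Z: "Z \<subseteq> T" "open Z" "0 \<in> Z"
    have "\<forall>\<^sub>F n in sequentially. g n \<in> Z" using g(2) Z by (auto simp: tendsto_def)
    then obtain n where "g n \<in> Z" by (auto simp: eventually_sequentially)
    \<comment> \<open>\<open>Z \<inter> W n\<close> is open and contains \<open>g n\<close>, so it
      cannot lie in \<open>K n\<close>, whose interior is empty.\<close>
    then have "\<not> Z \<inter> W n \<subseteq> K n"
      using int W Z by (metis IntI empty_iff interior_maximal open_Int subsetD)
    then show "U \<inter> T \<noteq> {}" using Z(1) by (auto simp: U_def)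
  qed
  ultimately obtain f where f: "range f \<subseteq> U" "f \<longlonglongrightarrow> 0" using lim by blast
  have "compact (insert 0 (range f))" 
    using compactin_sequence_with_limit[of euclidean f 0 "range f"] f(2) by simp
  then obtain m where m: "insert 0 (range f) \<subseteq> K m" using exhaust by blast
  have "open (\<Inter>n<m. S n)" "0 \<in> (\<Inter>n<m. S n)" using S by auto
  then have "\<forall>\<^sub>F j in sequentially. f j \<in> (\<Inter>n<m. S n)" using f(2) by (auto simp: tendsto_def)
  then obtain j where j: "f j \<in> (\<Inter>n<m. S n)" by (auto simp: eventually_sequentially)
  obtain n where n: "f j \<in> W n" "f j \<notin> K n" using f(1) by (auto simp: U_def)
  have "n < m"
    using m n(2) incseqD[OF \<open>incseq K\<close>, of m n] by (meson insert_subset not_le range_subsetD subsetD)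
  then show False using j n(1) S(3) by blast
qed

theorem proposition2p2:
  assumes "hemicompact_space (euclidean :: 'a::{topological_group_add, t2_space} topology)"
  shows "(kappa_Frechet_Urysohn_space (euclidean :: 'a topology) \<longleftrightarrow>
            locally_compact_space (euclidean :: 'a topology)) \<and>
         (locally_compact_space (euclidean :: 'a topology) \<longleftrightarrow>
            Baire_space (euclidean :: 'a topology))"
proof -
  obtain K :: "nat \<Rightarrow> 'a set" where K: "incseq K" "\<And>n. compact (K n)"
      "\<And>C. compact C \<Longrightarrow> \<exists>n. C \<subseteq> K n"
    using assms by (auto simp: hemicompact_space_def)
  have "(\<Union>n. K n) = UNIV"
    using K(3) by (metis UNIV_eq_I UN_iff UNIV_I compact_sing insert_subset)
  \<comment> \<open>An interior point of some \<open>K n\<close> yields local compactness, so both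
    converse implications reduce to finding one.\<close>
  then show ?thesis
    using locally_compact_group_imp_kappa_Frechet_Urysohn
      locally_compact_Hausdorff_imp_Baire_space[OF _ Hausdorff_space_euclidean_t2]
      Baire_sigma_compact_has_interior[of K]
      hemicompact_kappa_Frechet_Urysohn_has_interior[OF _ K]
      locally_compact_group_iff K(2)
    by metis
qed

end
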